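(* For the order-$r$ Richardson-extrapolated Gaussian kernel density estimator built from $n$ data points in $\mathbb{R}^d$, with mean squared error of order $$MSE=O\!\left(\frac{1}{n^{4r/(4r+d)}}\left(\frac{2r}{e}\right)^{2rd/(4r+d)}\right),$$ setting the derivative of this order of the MSE with respect to $r$ equal to $0$, $$\frac{d\,MSE}{dr}=2^{\frac{2dr}{4r+d}+1}e^{-\frac{2dr}{4r+d}}r^{\frac{2dr}{4r+d}}n^{\frac{-4r}{4r+d}}(4r+d)^{-2}\,d\,\big(-2\ln(n)+4r+d\ln(r)+d\ln(2)\big)=0,$$ yields $-2\ln(n)+4r+d\ln(r)+d\ln(2)=0$, and the solution of this equation gives the best value of $r$ (the best order of the Richardson extrapolation) given $n$ data points: $$r=\frac14\,d\,W\!\left(\frac{2n^{2/d}}{d}\right).$$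
   Context: $W$ is the Lambert $W$ function (product logarithm), the inverse of $f(W)=We^W$. On the left of the derivative formula $d$ is the differential; elsewhere it is the dimension. For a bandwidth $h>0$ and data $X_1,\dots,X_n\in\mathbb{R}^d$, the Gaussian kernel density estimator is $\hat p_{n,h}(x)=\frac{1}{nh^d}\sum_{i=1}^n\frac{e^{-(\|x-X_i\|/h)^2/2}}{(2\pi)^{d/2}}$. The order-$r$ Richardson-extrapolated estimator is $\hat p_{n,r}(x)=\sum_{i=1}^r c_i\hat p_{n,h_i}(x)$ with distinct bandwidths $h_1,\dots,h_r$ and weights $c_i=\prod_{j\ne i}\frac{-h_j^2}{h_i^2-h_j^2}$, i.e. $\sum_i c_i=1$ and $\sum_i c_ih_i^{2k}=0$ for $1\le k\le r-1$. The displayed order of the MSE arises by balancing the squared bias, of order $(2r/e)^{2r}h^{4r}$ (the growth of the derivative of order $2r$ being computed for the standard normal density as an example), against the variance, of order $1/(nh^d)$, which gives bandwidths approximately equal to $h=n^{-1/(4r+d)}\left(\frac{e}{2r}\right)^{2r/(4r+d)}$. "Best" is meant in the sense of this order-of-magnitude, derivative-equals-zero argument, with $r$ treated as a real variable. *)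

theory Defs
  imports "HOL-Probability.Probability" "HOL-Library.Landau_Symbols"
begin

definition gaussian_kde :: "(nat \<Rightarrow> 'a::euclidean_space) \<Rightarrow> nat \<Rightarrow> real \<Rightarrow> 'a \<Rightarrow> real" where
  "gaussian_kde X n h x =
     1 / (real n * h ^ DIM('a)) *
     (\<Sum>i = 1..n. exp (- ((norm (x - X i) / h)\<^sup>2 / 2)) / (2 * pi) powr (real DIM('a) / 2))"

definition richardson_weight :: "(nat \<Rightarrow> real) \<Rightarrow> nat \<Rightarrow> nat \<Rightarrow> real" where
  "richardson_weight h r i = (\<Prod>j \<in> {1..r} - {i}. - (h j)\<^sup>2 / ((h i)\<^sup>2 - (h j)\<^sup>2))"

definition richardson_kde ::
  "(nat \<Rightarrow> 'a::euclidean_space) \<Rightarrow> nat \<Rightarrow> (nat \<Rightarrow> real) \<Rightarrow> nat \<Rightarrow> 'a \<Rightarrow> real" where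
  "richardson_kde X n h r x = (\<Sum>i = 1..r. richardson_weight h r i * gaussian_kde X n (h i) x)"

definition richardson_mse ::
  "'w measure \<Rightarrow> (nat \<Rightarrow> 'w \<Rightarrow> 'a::euclidean_space) \<Rightarrow> ('a \<Rightarrow> real) \<Rightarrow> 'a \<Rightarrow>
     nat \<Rightarrow> (nat \<Rightarrow> real) \<Rightarrow> nat \<Rightarrow> real" where
  "richardson_mse M X p x n h r =
     (\<integral>\<omega>. (richardson_kde (\<lambda>i. X i \<omega>) n h r x - p x)\<^sup>2 \<partial>M)"

text \<open>Orders of magnitude without implied constants. The factor (2r/e)^(2r) in the
  squared bias is the growth of the derivative of order 2r of the standard normal density.\<close>

definition sq_bias_order :: "real \<Rightarrow> real \<Rightarrow> real" where
  "sq_bias_order r h = (2 * r / exp 1) powr (2 * r) * h powr (4 * r)"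

definition variance_order :: "nat \<Rightarrow> nat \<Rightarrow> real \<Rightarrow> real" where
  "variance_order n d h = 1 / (real n * h ^ d)"

definition balanced_bandwidth :: "nat \<Rightarrow> nat \<Rightarrow> real \<Rightarrow> real" where
  "balanced_bandwidth n d r =
     real n powr (- 1 / (4 * r + real d)) * (exp 1 / (2 * r)) powr (2 * r / (4 * r + real d))"

text \<open>The order of the mean squared error without its implied constant, with the order
  of extrapolation r relaxed to a real variable.\<close>

definition mse_order :: "nat \<Rightarrow> nat \<Rightarrow> real \<Rightarrow> real" where
  "mse_order n d r =
     1 / real n powr (4 * r / (4 * r + real d)) *
     (2 * r / exp 1) powr (2 * r * real d / (4 * r + real d))"

text \<open>The order is the common value of the squared bias and the variance at the bandwidth that
  balances them.\<close>

lemma mse_order_balance: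
  assumes n: "n \<ge> 1" and r: "r > 0"
  shows "sq_bias_order r (balanced_bandwidth n d r) = mse_order n d r"
    and "variance_order n d (balanced_bandwidth n d r) = mse_order n d r"
proof -
  define s where "s = 4 * r + real d"
  define a where "a = ln (real n)"
  define b where "b = ln (2 * r / exp 1)"
  have s: "s > 0" using r by (simp add: s_def add_pos_nonneg)
  have npos: "real n > 0" using n by simp
  have bpos: "2 * r / exp 1 > 0" using r by simp
  have inv: "ln (exp 1 / (2 * r)) = - b"
    using r unfolding b_def by (simp add: ln_div)
  have nexp: "real n = exp a" using npos by (simp add: a_def)
  have hb: "balanced_bandwidth n d r = exp (- (a + 2 * r * b) / s)"
    using npos r inv
    by (simp add: balanced_bandwidth_def powr_def s_def[symmetric] a_def[symmetric]
        exp_add[symmetric] add_divide_distrib diff_divide_distrib)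
  have mo: "mse_order n d r = exp ((2 * r * real d * b - 4 * r * a) / s)"
    using npos r
    by (simp add: mse_order_def powr_def s_def[symmetric] a_def[symmetric] b_def[symmetric]
        exp_diff diff_divide_distrib)
  have "sq_bias_order r (balanced_bandwidth n d r) =
      exp (2 * r * b + 4 * r * (- (a + 2 * r * b) / s))"
    using r by (simp add: sq_bias_order_def hb powr_def b_def[symmetric] exp_add)
  also have "2 * r * b + 4 * r * (- (a + 2 * r * b) / s) = (2 * r * real d * b - 4 * r * a) / s"
    using s by (simp add: field_simps) (simp add: s_def algebra_simps)
  finally show "sq_bias_order r (balanced_bandwidth n d r) = mse_order n d r"
    by (simp add: mo)
  have "variance_order n d (balanced_bandwidth n d r) =
      exp (- (a + real d * (- (a + 2 * r * b) / s)))"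
    by (simp only: variance_order_def hb nexp exp_of_nat_mult[symmetric] exp_add[symmetric]
        exp_minus inverse_eq_divide)
  also have "- (a + real d * (- (a + 2 * r * b) / s)) = (2 * r * real d * b - 4 * r * a) / s"
    using s by (simp add: field_simps) (simp add: s_def algebra_simps)
  finally show "variance_order n d (balanced_bandwidth n d r) = mse_order n d r"
    by (simp add: mo)
qed

text \<open>The principal real branch, meaningful for arguments at least -1/e.\<close>

definition lambert_W :: "real \<Rightarrow> real" where
  "lambert_W = inv_into {-1..} (\<lambda>w. w * exp w)"

end

theory Submission
  imports Defs
begin

text \<open>With s = 4r + d, the logarithm of the order of the MSE is
  (2rd (ln (2r) - 1) - 4r ln n) / s, whose derivative is 2d / s^2 times
  -2 ln n + 4r + d ln r + d ln 2. The latter is strictly increasing in r, so its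
  root is unique and is the global minimiser of the order; and
  substituting r = d w / 4 turns its vanishing into w exp w = 2 n^(2/d) / d.\<close>

text \<open>\<open>inv_into\<close> returns a genuine preimage as soon as c lies in the image of
  \<open>{-1..}\<close>. The intermediate value theorem supplies this membership: at -1 the function
  takes the value \<open>- exp (-1)\<close>, which is where the bound on c comes from.\<close>

lemma lambert_W_mult_exp:
  assumes "c \<ge> - exp (-1)"
  shows "lambert_W c * exp (lambert_W c) = c"
proof -
  \<comment> \<open>Right endpoint for the intermediate value theorem: u is nonnegative, so
    \<open>exp u\<close> is at least 1 and \<open>u * exp u\<close> is at least u, hence at least
    c.\<close>
  define u where "u = max 0 c"
  have "1 * u \<le> exp u * u" by (rule mult_right_mono) (auto simp: u_def)
  then have "c \<le> u * exp u" by (simp add: u_def mult.commute)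
  then obtain w where "w \<ge> -1" "w * exp w = c"
    using IVT'[of "\<lambda>w. w * exp w" "-1" c u] assms
    by (force simp: u_def intro!: continuous_intros)
  then have c: "c \<in> (\<lambda>w. w * exp w) ` {-1..}" by force
  show ?thesis using f_inv_into_f[OF c] by (simp add: lambert_W_def)
qed

lemma lambert_W_pos: "c > 0 \<Longrightarrow> lambert_W c > 0"
proof -
  assume "c > 0"
  then have "c \<ge> - exp (-1)" using exp_gt_zero[of "-1::real"] by linarith
  from lambert_W_mult_exp[OF this] \<open>c > 0\<close> show ?thesis
    by (metis exp_gt_zero zero_less_mult_pos2)
qed

definition stationarity :: "nat \<Rightarrow> nat \<Rightarrow> real \<Rightarrow> real" where
  "stationarity n d r = - 2 * ln (real n) + 4 * r + real d * ln r + real d * ln 2"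

text \<open>Strictness comes from the term \<open>4 * r\<close>. The logarithm contributes a weak
  inequality, which survives multiplication by \<open>real d\<close> even for
  \<open>d = 0\<close>.\<close>

lemma stationarity_strict_mono:
  assumes "0 < a" "a < b"
  shows "stationarity n d a < stationarity n d b"
proof -
  have "ln a \<le> ln b" using assms by simp
  then have "real d * ln a \<le> real d * ln b" by (intro mult_left_mono) auto
  then show ?thesis using assms by (simp add: stationarity_def)
qed

lemma stationarity_lambert_W:
  assumes "n \<ge> 1" "d \<ge> 1"
  shows "stationarity n d (1 / 4 * real d * lambert_W (2 * real n powr (2 / real d) / real d)) = 0"
proof -
  define c where "c = 2 * real n powr (2 / real d) / real d"
  define w where "w = lambert_W c"
  have c: "c > 0" using assms by (simp add: c_def)
  have w: "w > 0" unfolding w_def using c by (rule lambert_W_pos)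
  have "c \<ge> - exp (-1)" using c exp_gt_zero[of "-1::real"] by linarith
  then have "ln (w * exp w) = ln c" by (simp add: w_def lambert_W_mult_exp)
  \<comment> \<open>Positivity of w allows the product to be split. The equation becomes linear in w
    and \<open>ln w\<close>, the two quantities that \<open>4 * r\<close> and \<open>ln r\<close>
    turn into.\<close>
  then have lw: "ln w + w = ln c" using w by (simp add: ln_mult)
  have lc: "ln c = ln 2 + 2 / real d * ln (real n) - ln (real d)"
    using assms by (simp add: c_def ln_div ln_mult ln_powr)
  \<comment> \<open>With \<open>ln 4\<close> in this form, the prefactor \<open>1 / 4\<close> and
    the summand \<open>real d * ln 2\<close> combine to a \<open>- ln 2\<close> that cancels the 2
    inside c.\<close>
  have l4: "ln (4::real) = 2 * ln 2" using ln_powr[of 2 2] by simp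
  have "ln (1 / 4 * real d * w) = ln (real d) + ln w - 2 * ln 2"
    using w assms l4 by (simp add: ln_div ln_mult)
  then have "stationarity n d (1 / 4 * real d * w) =
      - 2 * ln (real n) + real d * (w + ln w + ln (real d) - ln 2)"
    unfolding stationarity_def by (simp only:) (simp add: algebra_simps)
  also have "w + ln w + ln (real d) - ln 2 = 2 / real d * ln (real n)" using lw lc by simp
  also have "- 2 * ln (real n) + real d * (2 / real d * ln (real n)) = 0" using assms by simp
  finally show ?thesis by (simp add: w_def c_def)
qed

text \<open>Logarithmic differentiation: on the positive reals the order is
  \<open>exp (g t)\<close>, so its derivative is itself times that of the quotient g.\<close>

lemma mse_order_has_derivative:
  assumes n: "n \<ge> 1" and r: "r > 0"
  shows "(mse_order n d has_real_derivative
    mse_order n d r * (2 * real d / (4 * r + real d)\<^sup>2 * stationarity n d r)) (at r)"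
proof -
  define a where "a = ln (real n)"
  define g where "g = (\<lambda>r. (2 * r * real d * (ln r + ln 2 - 1) - 4 * r * a) / (4 * r + real d))"
  have eq: "mse_order n d t = exp (g t)" if "t > 0" for t
    using n that
    by (simp add: mse_order_def g_def powr_def a_def ln_div ln_mult exp_diff diff_divide_distrib add.commute)
  have s: "4 * r + real d > 0" using r by (simp add: add_pos_nonneg)
  have "(g has_real_derivative
      ((2 * real d * (ln r + ln 2 - 1) + 2 * real d - 4 * a) * (4 * r + real d)
        - (2 * r * real d * (ln r + ln 2 - 1) - 4 * r * a) * 4) / (4 * r + real d)\<^sup>2) (at r)"
    unfolding g_def using r s
    by (auto intro!: derivative_eq_intros simp: power2_eq_square)
  \<comment> \<open>In the numerator from the quotient rule the products of r with the logarithms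
    cancel, and the -1 is compensated by the summand \<open>2 * real d\<close>, which stems from
    \<open>r * (1 / r)\<close>.\<close>
  also have "(2 * real d * (ln r + ln 2 - 1) + 2 * real d - 4 * a) * (4 * r + real d)
        - (2 * r * real d * (ln r + ln 2 - 1) - 4 * r * a) * 4 = 2 * real d * stationarity n d r"
    by (simp add: stationarity_def a_def algebra_simps)
  finally have "((\<lambda>t. exp (g t)) has_real_derivative
      exp (g r) * (2 * real d / (4 * r + real d)\<^sup>2 * stationarity n d r)) (at r)"
    by (auto intro!: derivative_eq_intros)
  \<comment> \<open>The exponential form is known only for positive arguments; agreement on this
    open set around r suffices to transfer the derivative.\<close>
  moreover have "\<forall>\<^sub>F t in nhds r. exp (g t) = mse_order n d t"
    using eventually_nhds_in_open[of "{0<..}" r] r by (auto elim!: eventually_mono simp: eq)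
  ultimately show ?thesis
    using DERIV_cong_ev[OF refl _ refl] eq[OF r] by metis
qed

lemma mse_order_pos: "n \<ge> 1 \<Longrightarrow> r > 0 \<Longrightarrow> mse_order n d r > 0"
  by (simp add: mse_order_def)

text \<open>Bridges to the factored form of the derivative in the theorem: the 2 of
  \<open>2 * real d\<close> is absorbed into the exponent of 2 as the summand 1.\<close>

lemma mse_order_eq_powr:
  assumes "n \<ge> 1" "r > 0"
  shows "2 * mse_order n d r =
    2 powr (2 * real d * r / (4 * r + real d) + 1) * exp (- (2 * real d * r / (4 * r + real d)))
      * r powr (2 * real d * r / (4 * r + real d)) * real n powr (- 4 * r / (4 * r + real d))"
proof -
  define E where "E = 2 * real d * r / (4 * r + real d)"
  have E: "2 * r * real d / (4 * r + real d) = E" by (simp add: E_def mult_ac)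
  have "(2 * r / exp 1) powr E = 2 powr E * r powr E * exp (- E)"
    using assms by (simp add: powr_divide powr_mult exp_minus field_simps powr_def[of "exp 1"])
  then show ?thesis
    unfolding mse_order_def E E_def[symmetric]
    by (simp add: powr_add powr_minus_divide)
qed

lemma continuous_on_mse_order:
  assumes "n \<ge> 1"
  shows "continuous_on {0<..} (mse_order n d)"
  by (intro continuous_at_imp_continuous_on ballI, rule DERIV_isCont,
      rule mse_order_has_derivative[OF assms]) simp

text \<open>The derivative has the sign of \<open>stationarity\<close>, which is negative before its
  zero q and positive after it, so the order falls strictly up to q and rises strictly from
  there.\<close>

lemma mse_order_strict_min:
  assumes n: "n \<ge> 1" and d: "d \<ge> 1" and q: "q > 0" "stationarity n d q = 0"
    and r: "r > 0" "r \<noteq> q"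
  shows "mse_order n d q < mse_order n d r"
proof (cases "r < q")
  case True
  \<comment> \<open>The derivative vanishes at q itself, so its sign is used only in the open
    interval, with continuity covering the endpoints.\<close>
  show ?thesis
  proof (rule DERIV_neg_imp_decreasing_open[OF True])
    fix t assume t: "r < t" "t < q"
    then have "stationarity n d t < 0" using stationarity_strict_mono[of t q n d] r q by simp
    then have "mse_order n d t * (2 * real d / (4 * t + real d)\<^sup>2 * stationarity n d t) < 0"
      using t r d mse_order_pos[OF n, of t d]
      by (intro mult_pos_neg) (auto intro!: divide_pos_pos zero_less_power)
    then show "\<exists>y. (mse_order n d has_real_derivative y) (at t) \<and> y < 0"
      using mse_order_has_derivative[OF n, of t d] t r by auto
  next
    show "continuous_on {r..q} (mse_order n d)"
      by (rule continuous_on_subset[OF continuous_on_mse_order[OF n]]) (use r in auto)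
  qed
next
  case False
  then have qr: "q < r" using r by simp
  show ?thesis
  proof (rule DERIV_pos_imp_increasing_open[OF qr])
    fix t assume t: "q < t" "t < r"
    then have "stationarity n d t > 0" using stationarity_strict_mono[of q t n d] q by simp
    then have "mse_order n d t * (2 * real d / (4 * t + real d)\<^sup>2 * stationarity n d t) > 0"
      using t q d mse_order_pos[OF n, of t d]
      by (intro mult_pos_pos) (auto intro!: divide_pos_pos zero_less_power)
    then show "\<exists>y. (mse_order n d has_real_derivative y) (at t) \<and> y > 0"
      using mse_order_has_derivative[OF n, of t d] t q by auto
  next
    show "continuous_on {q..r} (mse_order n d)"
      by (rule continuous_on_subset[OF continuous_on_mse_order[OF n]]) (use q in auto)
  qed
qed

theorem mainTheorem5:
  fixes M :: "'w measure"
    and X :: "nat \<Rightarrow> 'w \<Rightarrow> 'a::euclidean_space"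
    and p :: "'a \<Rightarrow> real"
    and x :: 'a
    and h :: "nat \<Rightarrow> nat \<Rightarrow> nat \<Rightarrow> real"
    and n :: nat
  assumes "prob_space M"
    and "prob_space.indep_vars M (\<lambda>_. borel) X {1..}"
    and "\<And>y. p y \<ge> 0"
    and "\<And>i. i \<ge> 1 \<Longrightarrow> distributed M lborel (X i) (\<lambda>y. ennreal (p y))"
    and "\<And>r N i. r \<ge> 1 \<Longrightarrow> N \<ge> 1 \<Longrightarrow> i \<in> {1..r} \<Longrightarrow> h r N i > 0"
    and "\<And>r N. r \<ge> 1 \<Longrightarrow> N \<ge> 1 \<Longrightarrow> inj_on (h r N) {1..r}"
    and "\<And>r i. r \<ge> 1 \<Longrightarrow> i \<in> {1..r} \<Longrightarrow>
           (\<lambda>N. h r N i) \<in> \<Theta>(\<lambda>N. balanced_bandwidth N DIM('a) (real r))"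
    and "\<And>r. r \<ge> 1 \<Longrightarrow>
           (\<lambda>N. richardson_mse M X p x N (h r N) r) \<in> O(\<lambda>N. mse_order N DIM('a) (real r))"
    and "n \<ge> 1"
  shows "let d = real DIM('a);
             MSE = mse_order n DIM('a);
             r_best = 1 / 4 * d * lambert_W (2 * real n powr (2 / d) / d)
         in (\<forall>r > 0. (MSE has_real_derivative
                2 powr (2 * d * r / (4 * r + d) + 1) * exp (- (2 * d * r / (4 * r + d)))
                * r powr (2 * d * r / (4 * r + d)) * real n powr (- 4 * r / (4 * r + d))
                * (4 * r + d) powi (-2) * d
                * (- 2 * ln (real n) + 4 * r + d * ln r + d * ln 2)) (at r))
          \<and> (\<forall>r > 0. deriv MSE r = 0 \<longleftrightarrow> - 2 * ln (real n) + 4 * r + d * ln r + d * ln 2 = 0)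
          \<and> (\<forall>r > 0. - 2 * ln (real n) + 4 * r + d * ln r + d * ln 2 = 0 \<longleftrightarrow> r = r_best)
          \<and> r_best > 0
          \<and> is_arg_min MSE (\<lambda>r. r > 0) r_best"
proof -
  define d where "d = DIM('a)"
  define q where "q = 1 / 4 * real d * lambert_W (2 * real n powr (2 / real d) / real d)"
  have n: "n \<ge> 1" by fact
  have d: "d \<ge> 1" by (simp add: d_def Suc_leI)
  have q: "q > 0" using n d by (simp add: q_def lambert_W_pos)
  have q0: "stationarity n d q = 0" unfolding q_def using n d by (rule stationarity_lambert_W)
  have der: "(mse_order n d has_real_derivative
      2 powr (2 * real d * r / (4 * r + real d) + 1) * exp (- (2 * real d * r / (4 * r + real d)))
      * r powr (2 * real d * r / (4 * r + real d)) * real n powr (- 4 * r / (4 * r + real d))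
      * (4 * r + real d) powi (-2) * real d * stationarity n d r) (at r)"
    if "r > 0" for r
  proof -
    have "mse_order n d r * (2 * real d / (4 * r + real d)\<^sup>2 * stationarity n d r) =
        2 * mse_order n d r * (4 * r + real d) powi (-2) * real d * stationarity n d r"
      by (simp add: power_int_minus divide_inverse mult_ac)
    then show ?thesis
      using mse_order_has_derivative[OF n that, of d]
      unfolding mse_order_eq_powr[OF n that] by metis
  qed
  have deriv0: "deriv (mse_order n d) r = 0 \<longleftrightarrow> stationarity n d r = 0" if "r > 0" for r
  proof -
    \<comment> \<open>A nonzero denominator, a positive order and \<open>d \<ge> 1\<close> leave
      \<open>stationarity\<close> as the only factor that can vanish.\<close>
    have "4 * r + real d \<noteq> 0" using that by (simp add: add_pos_nonneg less_imp_neq[symmetric])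
    then show ?thesis
      using DERIV_imp_deriv[OF mse_order_has_derivative[OF n that]] mse_order_pos[OF n that, of d] d by simp
  qed
  have root: "stationarity n d r = 0 \<longleftrightarrow> r = q" if "r > 0" for r
    \<comment> \<open>Trichotomy: on either side of q strict monotonicity forces a nonzero
      value.\<close>
    using stationarity_strict_mono[of r q n d] stationarity_strict_mono[of q r n d] that q q0
    by (cases r q rule: linorder_cases) auto
  have "is_arg_min (mse_order n d) (\<lambda>r. r > 0) q"
    unfolding is_arg_min_def
    using q mse_order_strict_min[OF n d q q0] by (metis less_asym)
  then show ?thesis
    unfolding Let_def d_def[symmetric] q_def[symmetric] stationarity_def[symmetric]
    using der deriv0 root q by blast
qed

end
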